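(* Let $(B_n)_{n\ge 0}$ be the balancing sequence. All non-negative integer solutions $(n_1,n_2,a_1,a_2,a_3)$ of the equation $$B_{n_1}+B_{n_2}=2^{a_1}+2^{a_2}+2^{a_3}$$ with $n_1\ge n_2\ge 0$ and $a_1\ge a_2\ge a_3\ge 0$ are given by $$(n_1,n_2,a_1,a_2,a_3)\in\{(2,0,1,1,1),(2,0,2,0,0),(2,1,2,1,0),(2,2,2,2,2),(2,2,3,1,1),(3,0,5,1,0),(3,1,4,4,2),(3,1,5,1,1),(3,2,5,3,0),(3,3,6,2,1)\}.$$
   Context: The balancing sequence $(B_n)_{n\ge 0}$ is defined by $B_0=0$, $B_1=1$ and $B_{n+1}=6B_n-B_{n-1}$ for $n\ge 1$. *)

theory Defs
  imports Main
begin

(* Integer-valued, so that the subtraction in the recurrence is not truncated. *)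
fun balancing :: "nat \<Rightarrow> int" where
  "balancing 0 = 0"
| "balancing (Suc 0) = 1"
| "balancing (Suc (Suc n)) = 6 * balancing (Suc n) - balancing n"

end

theory Submission
  imports Defs "HOL-Number_Theory.Cong"
begin

text \<open>
  The proof is a congruence sieve that excludes all large exponents at once.

  Modulo an odd prime \<open>p\<close>, both \<open>B\<^sub>n\<close> and \<open>2 ^ a\<close> are periodic, and for some primes both
  periods divide a number \<open>L = 2 ^ i \<cdot> 3 ^ j\<close>: 97 with \<open>L = 48\<close>, 769 with \<open>L = 384\<close>, 12289
  with \<open>L = 6144\<close>. Such \<open>L\<close> can be arranged in chains. Modulo \<open>2 ^ s\<close> the period of \<open>B\<^sub>n\<close> is \<open>2 ^ s\<close>.
  So the equation modulo such numbers restricts the residues of \<open>n\<^sub>1, n\<^sub>2, a\<^sub>1, a\<^sub>2\<close> modulo \<open>L\<close>.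
  The sieve walks through \<open>L = 4, 12, 24, 48, \<dots>, 18432\<close>, each dividing the next; it splits the
  surviving classes at each step and tests them with primes whose periods divide the new \<open>L\<close>.
  Splitting by 2 multiplies the number of classes by 16, which one new prime and the new power
  of 2 usually more than compensate, so few classes survive and at the end none does
  (\<open>infeasible_imp_no_solution\<close>, \<open>levels_infeasible_0\<close> and its companions).

  Two facts make this finite. First, \<open>a\<^sub>3 \<le> 2\<close> (\<open>smallest_exponent_le_2\<close>): if 8 divides
  \<open>B\<^sub>n + B\<^sub>m\<close>, then so does 51, whereas 51 divides no sum of three powers of 2. So \<open>a\<^sub>3\<close> can be
  treated as a constant. Secondly, the sieve must not meet an actual solution, as its residue
  classes would survive for ever. The equation is therefore sieved under the
  hypothesis \<open>a\<^sub>1 \<ge> 11\<close>, which enters through \<open>2 ^ a\<^sub>1 = 0\<close> modulo \<open>2 ^ 11\<close>. The solutions in the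
  theorem all have \<open>a\<^sub>1 \<le> 6\<close>, but the recurrence run backwards gives \<open>B\<^sub>-\<^sub>3 = - 35\<close> and
  \<open>B\<^sub>5 + B\<^sub>-\<^sub>3 = 1154 = 2 ^ 10 + 2 ^ 7 + 2\<close>. Natural numbers in the same classes pass
  all the tests modulo odd primes; this is what forces the bound up to 11.
  What remains is \<open>a\<^sub>1 \<le> 10\<close>, hence \<open>n\<^sub>1 \<le> 5\<close>, a small enumeration.
\<close>

section \<open>Addition formula and periodicity\<close>

lemma balancing_add:
  "balancing (m + Suc n) = balancing (Suc m) * balancing (Suc n) - balancing m * balancing n"
  by (induction m rule: balancing.induct) (simp_all add: algebra_simps)

text \<open>Doubling makes residues of \<open>B\<^sub>n\<close> computable in a logarithmic number of steps.\<close>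

lemma balancing_double:
  "balancing (2 * n) = balancing n * (2 * balancing (Suc n) - 6 * balancing n)"
  "balancing (Suc (2 * n)) = balancing (Suc n) * balancing (Suc n) - balancing n * balancing n"
proof -
  show odd: "balancing (Suc (2 * n)) = balancing (Suc n) * balancing (Suc n) - balancing n * balancing n"
    using balancing_add[of n n] by (simp add: mult_2)
  have "balancing (Suc (Suc (2 * n))) = balancing (Suc (Suc n)) * balancing (Suc n) - balancing (Suc n) * balancing n"
    using balancing_add[of "Suc n" n] by (simp add: mult_2)
  moreover have "balancing (Suc (Suc (2 * n))) = 6 * balancing (Suc (2 * n)) - balancing (2 * n)"
    by simp
  ultimately show "balancing (2 * n) = balancing n * (2 * balancing (Suc n) - 6 * balancing n)"
    using odd by (simp add: algebra_simps)
qed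

text \<open>
  The recurrence has order two, so a period is certified by the two values after one
  turn; it need not be the least period.
\<close>

lemma balancing_cong_mod:
  assumes "[balancing L = 0] (mod M)" "[balancing (Suc L) = 1] (mod M)"
  shows "[balancing (n mod L) = balancing n] (mod M)"
proof -
  have shift: "[balancing (n + L) = balancing n] (mod M)" for n
  proof (cases n)
    case 0
    then show ?thesis using assms by simp
  next
    case (Suc k)
    have "[balancing (Suc k) * balancing (Suc L) - balancing k * balancing L
         = balancing (Suc k) * 1 - balancing k * 0] (mod M)"
      by (intro cong_diff cong_mult cong_refl assms)
    then show ?thesis using balancing_add[of k L] Suc by simp
  qed
  have "[balancing (r + k * L) = balancing r] (mod M)" for r k
  proof (induction k)
    case (Suc k)
    have "[balancing (r + k * L + L) = balancing (r + k * L)] (mod M)" by (rule shift)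
    then show ?case using Suc by (metis add.assoc add.commute cong_trans mult_Suc)
  qed simp
  from this[of "n mod L" "n div L"] show ?thesis
    by (simp add: cong_sym_eq)
qed

lemma power_two_cong_mod:
  fixes M :: int
  assumes "[2 ^ L = 1] (mod M)"
  shows "[2 ^ (n mod L) = 2 ^ n] (mod M)"
proof -
  have "[(2 ^ L) ^ (n div L) * 2 ^ (n mod L) = 1 ^ (n div L) * 2 ^ (n mod L)] (mod M)"
    by (intro cong_mult cong_pow cong_refl assms)
  moreover have "(2 ^ L) ^ (n div L) * 2 ^ (n mod L) = (2 ^ n :: int)"
    by (simp flip: power_mult power_add)
  ultimately show ?thesis
    by (simp add: cong_sym_eq)
qed

section \<open>The smallest exponent is at most two\<close>

text \<open>
  2 has order 2 modulo 3 and order 8 modulo 17. Divisibility by 3 forces \<open>x\<close> and \<open>y\<close> to be even,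
  but modulo 17 the sum vanishes only for residues of \<open>(x, y)\<close> modulo 8 equal to \<open>(3, 3)\<close>, \<open>(0, 5)\<close>
  or \<open>(5, 0)\<close>.
\<close>

lemma fiftyone_not_dvd_three_powers: "\<not> (51::int) dvd 1 + 2 ^ x + 2 ^ y"
proof
  assume "51 dvd (1 + 2 ^ x + 2 ^ y :: int)"
  then have "[1 + 2 ^ x + 2 ^ y = (0::int)] (mod 51)"
    by (simp add: cong_0_iff)
  moreover have "[1 + 2 ^ (x mod 8) + 2 ^ (y mod 8) = 1 + 2 ^ x + (2 ^ y :: int)] (mod 51)"
    by (intro cong_add cong_refl power_two_cong_mod) (simp_all add: cong_def)
  ultimately have "(1 + 2 ^ (x mod 8) + 2 ^ (y mod 8)) mod 51 = (0::int)"
    by (metis cong_def cong_trans mod_0)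
  moreover have "x mod 8 \<in> {0,1,2,3,4,5,6,7}" "y mod 8 \<in> {0,1,2,3,4,5,6,7}"
    by auto
  ultimately show False by auto
qed

text \<open>
  Modulo 8 the residues of \<open>B\<^sub>0, \<dots>, B\<^sub>7\<close> are distinct and \<open>B\<^sub>8\<^sub>-\<^sub>n = - B\<^sub>n\<close>, so 8 divides
  \<open>B\<^sub>n + B\<^sub>m\<close> only if 8 divides \<open>n + m\<close>. Since 8 is a period and \<open>B\<^sub>8\<^sub>-\<^sub>n = - B\<^sub>n\<close> also
  modulo \<open>408 = 8 \<cdot> 51\<close>, the sum then vanishes modulo 51.
\<close>

lemma eight_dvd_imp_fiftyone_dvd:
  assumes "8 dvd balancing n + balancing m"
  shows "51 dvd balancing n + balancing m"
proof -
  have *: "[balancing (n mod 8) + balancing (m mod 8) = balancing n + balancing m] (mod 408)"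
    by (intro cong_add balancing_cong_mod) (simp_all add: cong_def eval_nat_numeral)
  have "8 dvd balancing (n mod 8) + balancing (m mod 8)"
    using assms cong_dvd_iff[OF cong_dvd_modulus[OF *, of 8]] by simp
  moreover have "n mod 8 \<in> {0,1,2,3,4,5,6,7}" "m mod 8 \<in> {0,1,2,3,4,5,6,7}"
    by auto
  moreover have "balancing 2 = 6" "balancing 3 = 35" "balancing 4 = 204" "balancing 5 = 1189"
    "balancing 6 = 6930" "balancing 7 = 40391"
    by (simp_all add: eval_nat_numeral)
  ultimately have "51 dvd balancing (n mod 8) + balancing (m mod 8)"
    by auto
  then show ?thesis
    using cong_dvd_iff[OF cong_dvd_modulus[OF *, of 51]] by simp
qed

lemma smallest_exponent_le_2:
  assumes "balancing n + balancing m = 2 ^ a + 2 ^ b + 2 ^ c" "c \<le> b" "b \<le> a"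
  shows "c \<le> 2"
proof (rule ccontr)
  assume "\<not> c \<le> 2"
  then have "2 ^ 3 dvd (2 ^ c :: int)" by (intro le_imp_power_dvd) simp
  moreover have split: "2 ^ a + 2 ^ b + 2 ^ c = 2 ^ c * (1 + 2 ^ (a - c) + 2 ^ (b - c) :: int)"
    using assms by (simp add: algebra_simps flip: power_add)
  ultimately have "8 dvd balancing n + balancing m"
    by (simp add: assms(1) dvd_mult2)
  then have "51 dvd 2 ^ c * (1 + 2 ^ (a - c) + 2 ^ (b - c) :: int)"
    using eight_dvd_imp_fiftyone_dvd assms(1) split by metis
  moreover have "coprime (51::int) (2 ^ c)"
    by (simp add: coprime_power_right_iff coprime_right_2_iff_odd)
  ultimately show False
    using fiftyone_not_dvd_three_powers by (simp add: coprime_dvd_mult_right_iff)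
qed

section \<open>Fast evaluation modulo a fixed integer\<close>

text \<open>
  The functions of this section are meant for evaluation by rewriting, where the branching
  recursion of \<open>balancing\<close> would be hopeless for indices in the thousands. The first component of
  \<open>balancing_mod M n\<close> is \<open>B\<^sub>n\<close> and the second \<open>B\<^sub>n\<^sub>+\<^sub>1\<close>. Results are reduced only up to
  congruence: for \<open>M = 1\<close> the initial value 1 is left as it is.
\<close>

function balancing_mod :: "int \<Rightarrow> int \<Rightarrow> int \<times> int" where
  "balancing_mod M n = (if n \<le> 0 then (0, 1) else
     let (x, y) = balancing_mod M (n div 2);
         u = x * (2 * y - 6 * x) mod M; v = (y * y - x * x) mod M
     in if even n then (u, v) else (v, (6 * v - u) mod M))"
  by auto
termination by (relation "measure (\<lambda>(M, n). nat n)") auto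
declare balancing_mod.simps [simp del]

function power_two_mod :: "int \<Rightarrow> int \<Rightarrow> int" where
  "power_two_mod M n = (if n \<le> 0 then 1 else
     let x = power_two_mod M (n div 2) in (if even n then x * x else 2 * (x * x)) mod M)"
  by auto
termination by (relation "measure (\<lambda>(M, n). nat n)") auto
declare power_two_mod.simps [simp del]

lemma balancing_mod_cong:
  "[fst (balancing_mod M n) = balancing (nat n)] (mod M) \<and>
   [snd (balancing_mod M n) = balancing (Suc (nat n))] (mod M)"
proof (induction M n rule: balancing_mod.induct)
  case (1 M n)
  show ?case
  proof (cases "n \<le> 0")
    case True
    then show ?thesis by (simp add: balancing_mod.simps)
  next
    case False
    define k where "k = nat (n div 2)"
    obtain x y where xy: "balancing_mod M (n div 2) = (x, y)" by force
    have x: "[x = balancing k] (mod M)" and y: "[y = balancing (Suc k)] (mod M)"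
      using 1 False by (simp_all add: xy k_def)
    define u where "u = x * (2 * y - 6 * x) mod M"
    define v where "v = (y * y - x * x) mod M"
    have "[x * (2 * y - 6 * x) = balancing (2 * k)] (mod M)"
      unfolding balancing_double by (intro cong_mult cong_diff cong_refl x y)
    then have u: "[u = balancing (2 * k)] (mod M)" by (simp add: u_def cong_def)
    have "[y * y - x * x = balancing (Suc (2 * k))] (mod M)"
      unfolding balancing_double by (intro cong_mult cong_diff cong_refl x y)
    then have v: "[v = balancing (Suc (2 * k))] (mod M)" by (simp add: v_def cong_def)
    have "[6 * v - u = balancing (Suc (Suc (2 * k)))] (mod M)"
      unfolding balancing.simps by (intro cong_mult cong_diff cong_refl u v)
    then have w: "[(6 * v - u) mod M = balancing (Suc (Suc (2 * k)))] (mod M)"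
      by (simp add: cong_def)
    have step: "balancing_mod M n = (if even n then (u, v) else (v, (6 * v - u) mod M))"
      using False by (subst balancing_mod.simps) (simp add: xy u_def v_def Let_def)
    show ?thesis
    proof (cases "even n")
      case True
      then have "nat n = 2 * k" using False unfolding k_def by (auto simp: nat_mult_distrib elim!: evenE)
      then show ?thesis using True u v by (simp add: step)
    next
      case odd: False
      then have "nat n = Suc (2 * k)" using False unfolding k_def
        by (auto simp: nat_add_distrib nat_mult_distrib elim!: oddE)
      then show ?thesis using odd v w by (simp add: step)
    qed
  qed
qed

lemma power_two_mod_cong: "[power_two_mod M n = 2 ^ nat n] (mod M)"
proof (induction M n rule: power_two_mod.induct)
  case (1 M n)
  show ?case
  proof (cases "n \<le> 0")
    case True
    then show ?thesis by (simp add: power_two_mod.simps)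
  next
    case False
    define k where "k = nat (n div 2)"
    define x where "x = power_two_mod M (n div 2)"
    have x: "[x = 2 ^ k] (mod M)" using 1 False by (simp add: x_def k_def)
    have xx: "[x * x = 2 ^ (2 * k)] (mod M)"
      using cong_mult[OF x x] by (simp add: mult_2 power_add)
    have step: "power_two_mod M n = (if even n then x * x else 2 * (x * x)) mod M"
      using False by (subst power_two_mod.simps) (simp add: x_def Let_def)
    show ?thesis
    proof (cases "even n")
      case True
      then have "nat n = 2 * k" using False unfolding k_def by (auto simp: nat_mult_distrib elim!: evenE)
      then show ?thesis using True xx by (simp add: step cong_def)
    next
      case odd: False
      then have "nat n = Suc (2 * k)" using False unfolding k_def
        by (auto simp: nat_add_distrib nat_mult_distrib elim!: oddE)
      then show ?thesis using odd cong_mult[OF cong_refl[of 2] xx] by (simp add: step cong_def)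
    qed
  qed
qed

section \<open>The sieve\<close>

text \<open>The residue classes modulo \<open>L * k\<close> into which the class of \<open>r\<close> modulo \<open>L\<close> splits.\<close>

definition subclasses :: "int \<Rightarrow> int \<Rightarrow> int \<Rightarrow> int list" where
  "subclasses L k r = map (\<lambda>i. r + L * i) [0..k - 1]"

definition balancing_residues :: "int \<Rightarrow> int list \<Rightarrow> (int \<times> int) list" where
  "balancing_residues M = map (\<lambda>n. (n, fst (balancing_mod M n)))"

definition power_residues :: "int \<Rightarrow> int \<Rightarrow> int list \<Rightarrow> (int \<times> int \<times> int) list" where
  "power_residues q p = map (\<lambda>n. let x = power_two_mod (q * p) n in (n, x mod q, x mod p))"

text \<open>
  A depth-first search for classes \<open>(n, m, a, b)\<close> modulo \<open>L\<close>, with the exact exponent \<open>c\<close>, that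
  could contain a solution of \<open>B\<^sub>N + B\<^sub>M = 2 ^ A + 2 ^ B + 2 ^ c\<close>. A level \<open>(k, q, p)\<close> refines the
  modulus to \<open>L * k\<close> and tests modulo \<open>q\<close>, a power of 2, and modulo an odd number \<open>p\<close>.

  With \<open>s = B\<^sub>N + B\<^sub>M - 2 ^ c\<close>, the test modulo \<open>q\<close> says that \<open>s\<close> is 0 or \<open>2 ^ b'\<close>: the term
  \<open>2 ^ A\<close> vanishes because \<open>A\<close> is large, and \<open>2 ^ B\<close> vanishes as well unless \<open>B\<close> is so small that it
  equals its residue \<open>b'\<close>. The test modulo \<open>p\<close> is the equation itself.

  As \<open>N\<close> and \<open>M\<close> can be exchanged, a class with \<open>n = m\<close> needs only its subclasses with
  \<open>n' \<le> m'\<close>. The search uses conditionals in place of connectives because rewriting evaluates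
  the condition of a conditional first and skips the branch not taken.
\<close>

fun infeasible ::
  "(int \<times> int \<times> int) list \<Rightarrow> int \<Rightarrow> int \<times> int \<times> int \<times> int \<times> int \<Rightarrow> bool" where
  "infeasible [] L x = False"
| "infeasible ((k, q, p) # ls) L (n, m, a, b, c) =
     (let z = power_two_mod (q * p) c;
          as = power_residues q p (subclasses L k a);
          bs = power_residues q p (subclasses L k b);
          ms = balancing_residues (q * p) (subclasses L k m)
      in list_all (\<lambda>(n', x). list_all (\<lambda>(m', y).
           if n = m \<and> m' < n' then True
           else let s = x + y - z; t = s mod q
             in list_all (\<lambda>(b', wq, wp).
                  if t = 0 \<or> t = wq then
                    let v = (s - wp) mod p
                    in list_all (\<lambda>(a', _, w).
                         if w = v then infeasible ls (L * k) (n', m', a', b', c) else True) as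
                  else True) bs) ms)
         (balancing_residues (q * p) (subclasses L k n)))"

text \<open>
  The properties of the levels that make the search sound: \<open>L * k\<close> is a period of \<open>B\<^sub>n\<close>
  modulo \<open>q * p\<close> and of the powers of 2 modulo \<open>p\<close>; \<open>q\<close> divides \<open>2 ^ 11\<close>, so that \<open>2 ^ A\<close> vanishes
  modulo \<open>q\<close>, and \<open>2 ^ (L * k)\<close>, so that \<open>2 ^ B\<close> does unless \<open>B\<close> is its own residue.
\<close>

fun periods_ok :: "(int \<times> int \<times> int) list \<Rightarrow> int \<Rightarrow> bool" where
  "periods_ok [] L = True"
| "periods_ok ((k, q, p) # ls) L \<longleftrightarrow>
     (0 < k \<and> q dvd 2048 \<and> power_two_mod q (L * k) mod q = 0 \<and>
      power_two_mod p (L * k) mod p = 1 mod p \<and>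
      fst (balancing_mod (q * p) (L * k)) mod (q * p) = 0 \<and>
      snd (balancing_mod (q * p) (L * k)) mod (q * p) = 1 mod (q * p) \<and>
      periods_ok ls (L * k))"

lemma mod_in_subclasses:
  assumes "0 < k" "N mod L = r"
  shows "N mod (L * k) \<in> set (subclasses L k r)"
proof -
  have "N mod (L * k) = r + L * (N div L mod k)"
    using assms by (simp add: zmod_zmult2_eq)
  moreover have "N div L mod k \<in> {0..k - 1}"
    using assms by simp
  ultimately show ?thesis
    unfolding subclasses_def by auto
qed

text \<open>
  The subclass that contains a solution passes both tests, hence the search must have
  refuted it at a deeper level.
\<close>

lemma infeasible_step:
  fixes A B C M N :: nat
  assumes inf: "infeasible ((k, q, p) # ls) L (n, m, a, b, int C)"
    and ok: "periods_ok ((k, q, p) # ls) L" and "0 < L"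
    and sol: "balancing N + balancing M = 2 ^ A + 2 ^ B + 2 ^ C" and "11 \<le> A"
    and classes: "int N mod L = n" "int M mod L = m" "int A mod L = a" "int B mod L = b"
    and order: "\<not> (n = m \<and> int M mod (L * k) < int N mod (L * k))"
  shows "infeasible ls (L * k)
    (int N mod (L * k), int M mod (L * k), int A mod (L * k), int B mod (L * k), int C)"
proof -
  \<comment> \<open>The facts about periods are about natural numbers, the search computes with integers.\<close>
  define L' where "L' = nat (L * k)"
  have k: "0 < k" and q: "q dvd 2048" using ok by simp_all
  have L': "int L' = L * k" "0 < L'" using k \<open>0 < L\<close> by (simp_all add: L'_def)
  have int_mod: "nat (int X mod (L * k)) = X mod L'" for X
    using L' by (metis nat_int zmod_int)
  define x where "x X = fst (balancing_mod (q * p) (int X mod (L * k)))" for X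
  define w where "w X = power_two_mod (q * p) (int X mod (L * k))" for X
  have "[balancing L' = 0] (mod q * p)" "[balancing (Suc L') = 1] (mod q * p)"
    using ok balancing_mod_cong[of "q * p" "L * k"]
    by (simp_all add: L'_def cong_def)
  from balancing_cong_mod[OF this] have x: "[x X = balancing X] (mod q * p)" for X
    using balancing_mod_cong[of "q * p" "int X mod (L * k)"] cong_trans
    unfolding x_def int_mod by blast
  have "[2 ^ L' = 1] (mod p)"
    using ok power_two_mod_cong[of p "L * k"] by (simp add: L'_def cong_def)
  from power_two_cong_mod[OF this] have wp: "[w X = 2 ^ X] (mod p)" for X
    using cong_dvd_modulus[OF power_two_mod_cong[of "q * p" "int X mod (L * k)"], of p]
    unfolding w_def int_mod by (meson cong_trans dvd_triv_right)
  have "q dvd 2 ^ L'"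
    using ok power_two_mod_cong[of q "L * k"] by (simp add: L'_def cong_def mod_eq_0_iff_dvd)
  have wq: "[2 ^ B = 0] (mod q) \<or> [2 ^ B = w B] (mod q)"
  proof (cases "B < L'")
    case True
    then show ?thesis
      using cong_dvd_modulus[OF power_two_mod_cong[of "q * p" "int B mod (L * k)"], of q]
      unfolding w_def int_mod by (simp add: cong_sym_eq)
  next
    case False
    then have "2 ^ L' dvd (2 ^ B :: int)" by (intro le_imp_power_dvd) simp
    with \<open>q dvd 2 ^ L'\<close> have "q dvd 2 ^ B" by (rule dvd_trans)
    then show ?thesis by (simp add: cong_0_iff)
  qed
  define s where "s = x N + x M - power_two_mod (q * p) (int C)"
  have "[s = balancing N + balancing M - 2 ^ C] (mod q * p)"
    unfolding s_def using power_two_mod_cong[of "q * p" "int C"]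
    by (intro cong_add cong_diff x) simp
  then have s: "[s = 2 ^ A + 2 ^ B] (mod q * p)" using sol by simp
  have "2048 dvd (2 ^ A :: int)"
    using le_imp_power_dvd[OF \<open>11 \<le> A\<close>, of "2 :: int"] by simp
  with q have "q dvd 2 ^ A" by (rule dvd_trans)
  then have "[2 ^ A + 2 ^ B = 0 + 2 ^ B] (mod q)"
    by (intro cong_add cong_refl) (simp add: cong_0_iff)
  with cong_dvd_modulus[OF s, of q] have "[s = 2 ^ B] (mod q)"
    using cong_trans by fastforce
  with wq have test_q: "s mod q = 0 \<or> s mod q = w B mod q"
    by (auto simp: cong_def)
  have "[s - w B mod p = 2 ^ A + 2 ^ B - 2 ^ B] (mod p)"
    using cong_dvd_modulus[OF s, of p] wp[of B] by (intro cong_diff) (simp_all add: cong_def)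
  then have test_p: "w A mod p = (s - w B mod p) mod p"
    using wp[of A] by (simp add: cong_def)
  note sub = mod_in_subclasses[OF k]
  have mem_bal: "(int X mod (L * k), x X) \<in> set (balancing_residues (q * p) (subclasses L k r))"
    if "int X mod L = r" for X r
    using sub[OF that] unfolding balancing_residues_def x_def by auto
  have mem_pow: "(int X mod (L * k), w X mod q, w X mod p) \<in> set (power_residues q p (subclasses L k r))"
    if "int X mod L = r" for X r
    using sub[OF that] unfolding power_residues_def w_def by (auto simp: Let_def)
  show ?thesis
    using inf[unfolded infeasible.simps Let_def list_all_iff, rule_format,
        OF mem_bal[OF classes(1)], unfolded prod.case, rule_format,
        OF mem_bal[OF classes(2)], unfolded prod.case if_not_P[OF order], rule_format,
        OF mem_pow[OF classes(4)], unfolded prod.case, folded s_def, unfolded if_P[OF test_q],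
        rule_format, OF mem_pow[OF classes(3)], unfolded prod.case if_P[OF test_p]] .
qed

text \<open>
  \<open>N\<close> and \<open>M\<close> are generalized in the induction because the symmetry exchanges them on the way
  down.
\<close>

lemma infeasible_imp_no_solution:
  fixes A B C M N :: nat
  assumes "infeasible ls L (n, m, a, b, int C)" "periods_ok ls L" "0 < L"
    and "balancing N + balancing M = 2 ^ A + 2 ^ B + 2 ^ C" "11 \<le> A"
    and "int N mod L = n" "int M mod L = m" "int A mod L = a" "int B mod L = b"
  shows False
  using assms
proof (induction ls arbitrary: L n m a b N M)
  case Nil
  then show ?case by simp
next
  case (Cons l ls)
  obtain k q p where l: "l = (k, q, p)" by (cases l)
  note prems = Cons.prems[unfolded l]
  from prems have pos: "0 < L * k" and ok: "periods_ok ls (L * k)" by simp_all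
  show ?case
  proof (cases "n = m \<and> int M mod (L * k) < int N mod (L * k)")
    case False
    from Cons.IH[OF infeasible_step[OF prems False] ok pos prems(4,5) refl refl refl refl]
    show ?thesis .
  next
    case True
    have sol: "balancing M + balancing N = 2 ^ A + 2 ^ B + 2 ^ C"
      using prems(4) by simp
    have "int M mod L = n" "int N mod L = m" "\<not> (n = m \<and> int N mod (L * k) < int M mod (L * k))"
      using prems True by simp_all
    from Cons.IH[OF infeasible_step[OF prems(1-3) sol prems(5) this(1,2) prems(8,9) this(3)]
        ok pos sol prems(5) refl refl refl refl]
    show ?thesis .
  qed
qed

text \<open>
  The moduli reached are 4, 12, 24, 48, 96, 192, 384, 1152, 2304, 4608, 9216 and
  \<open>18432 = 2 ^ 11 \<cdot> 9\<close>; the second component of a level is always the exact power of 2 in its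
  modulus. The odd parts are products of primes \<open>p\<close> for which the order of 2 and the period
  of the sequence divide the modulus. At 384 the only surviving classes \<open>(n, m, a, b, c)\<close> are those
  of \<open>(5, -3, 10, 7, 1)\<close> and \<open>(5, -3, 7, 10, 1)\<close>, up to exchanging 5 and \<open>-3\<close>. No odd prime
  excludes them. The second one disappears modulo \<open>2 ^ 8\<close>, where the term \<open>2 ^ 7\<close> conflicts with
  \<open>2 ^ a = 0\<close>, the first one only modulo \<open>2 ^ 11\<close>, where \<open>2 ^ 10\<close> does. The factor 3 in the step
  to 1152 gives access to the primes 577, 18433 and 101377, which keep the number of subclasses
  small on the way there. The level of 9216 tests a power of 2 only, hence the odd part 1.
\<close>

definition levels :: "(int \<times> int \<times> int) list" where
  "levels = [(4, 4, 3), (3, 4, 5 * 7), (2, 8, 17), (2, 16, 97), (2, 32, 193), (2, 64, 257),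
     (2, 128, 769), (3, 128, 73 * 577), (2, 256, 18433), (2, 512, 101377), (2, 1024, 1),
     (2, 2048, 12289)]"

lemma levels_periods: "periods_ok levels 1"
  by code_simp

lemma levels_infeasible_0: "infeasible levels 1 (0, 0, 0, 0, 0)"
  by code_simp

lemma levels_infeasible_1: "infeasible levels 1 (0, 0, 0, 0, 1)"
  by code_simp

lemma levels_infeasible_2: "infeasible levels 1 (0, 0, 0, 0, 2)"
  by code_simp


lemma largest_exponent_le_10:
  assumes sol: "balancing n + balancing m = 2 ^ a + 2 ^ b + 2 ^ c" and "c \<le> b" "b \<le> a"
  shows "a \<le> 10"
proof (rule ccontr)
  assume "\<not> a \<le> 10"
  then have a: "11 \<le> a" by simp
  have "c = 0 \<or> c = 1 \<or> c = 2"
    using smallest_exponent_le_2[OF assms] by auto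
  then have "infeasible levels 1 (0, 0, 0, 0, int c)"
    using levels_infeasible_0 levels_infeasible_1 levels_infeasible_2 by auto
  from infeasible_imp_no_solution[OF this levels_periods _ sol a] show False by simp
qed

section \<open>Small solutions\<close>

lemma balancing_less_Suc: "balancing n < balancing (Suc n) \<and> 0 \<le> balancing n"
  by (induction n) auto

lemma balancing_mono: "m \<le> n \<Longrightarrow> balancing m \<le> balancing n"
  by (rule lift_Suc_mono_le[of balancing]) (use balancing_less_Suc less_imp_le in auto)

definition small_solutions :: "(nat \<times> nat \<times> nat \<times> nat \<times> nat) list" where
  "small_solutions = [(2, 0, 1, 1, 1), (2, 0, 2, 0, 0), (2, 1, 2, 1, 0), (2, 2, 2, 2, 2),
     (2, 2, 3, 1, 1), (3, 0, 5, 1, 0), (3, 1, 4, 4, 2), (3, 1, 5, 1, 1),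
     (3, 2, 5, 3, 0), (3, 3, 6, 2, 1)]"

text \<open>
  The enumeration carries each value next to its argument, so that every power and every
  balancing number is evaluated only once, and it stops as soon as the remaining sum is too small.
\<close>

lemma small_solutions_complete:
  "let balancings = map (\<lambda>k. (k, balancing k)) [0..<6];
       powers = map (\<lambda>k. (k, 2 ^ k :: int)) [0..<11];
       low_powers = map (\<lambda>k. (k, 2 ^ k :: int)) [0..<3]
   in list_all (\<lambda>(n1, x). list_all (\<lambda>(n2, y). if n1 < n2 then True else
        let r = x + y in list_all (\<lambda>(a1, u). if r < u then True else
          let s = r - u in list_all (\<lambda>(a2, v). if s < v then True else
            let t = s - v in list_all (\<lambda>(a3, w). if t = w then
              if a3 \<le> a2 then if a2 \<le> a1 then (n1, n2, a1, a2, a3) \<in> set small_solutions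
              else True else True else True)
            low_powers) powers) powers) balancings) balancings"
  by code_simp

theorem theorem1p1:
  shows "{(n1 :: nat, n2 :: nat, a1 :: nat, a2 :: nat, a3 :: nat).
            n1 \<ge> n2 \<and> n2 \<ge> 0 \<and> a1 \<ge> a2 \<and> a2 \<ge> a3 \<and> a3 \<ge> 0 \<and>
            balancing n1 + balancing n2 = 2 ^ a1 + 2 ^ a2 + 2 ^ a3} =
         {(2, 0, 1, 1, 1), (2, 0, 2, 0, 0), (2, 1, 2, 1, 0), (2, 2, 2, 2, 2),
          (2, 2, 3, 1, 1), (3, 0, 5, 1, 0), (3, 1, 4, 4, 2), (3, 1, 5, 1, 1),
          (3, 2, 5, 3, 0), (3, 3, 6, 2, 1)}" (is "?S = ?T")
proof (rule set_eqI, clarify, rule iffI)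
  fix n1 n2 a1 a2 a3
  assume "(n1, n2, a1, a2, a3) \<in> ?S"
  then have le: "n2 \<le> n1" "a2 \<le> a1" "a3 \<le> a2"
    and sol: "balancing n1 + balancing n2 = 2 ^ a1 + 2 ^ a2 + 2 ^ a3"
    by auto
  have a: "a1 \<le> 10" "a3 \<le> 2"
    using largest_exponent_le_10[OF sol] smallest_exponent_le_2[OF sol] le by auto
  \<comment> \<open>\<open>B\<^sub>6 = 6930\<close> exceeds \<open>3 \<cdot> 2 ^ 10\<close>.\<close>
  have "n1 \<le> 5"
  proof (rule ccontr)
    assume "\<not> n1 \<le> 5"
    then have "balancing 6 \<le> balancing n1" by (intro balancing_mono) simp
    moreover have "0 \<le> balancing n2" using balancing_less_Suc by simp
    moreover have "(2::int) ^ a1 \<le> 2 ^ 10" "(2::int) ^ a2 \<le> 2 ^ 10" "(2::int) ^ a3 \<le> 2 ^ 10"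
      using a le by (intro power_increasing; simp)+
    ultimately show False using sol by (simp add: eval_nat_numeral)
  qed
  then have mem: "(n1, balancing n1) \<in> set (map (\<lambda>k. (k, balancing k)) [0..<6])"
    "(n2, balancing n2) \<in> set (map (\<lambda>k. (k, balancing k)) [0..<6])"
    "(a1, 2 ^ a1 :: int) \<in> set (map (\<lambda>k. (k, 2 ^ k :: int)) [0..<11])"
    "(a2, 2 ^ a2 :: int) \<in> set (map (\<lambda>k. (k, 2 ^ k :: int)) [0..<11])"
    "(a3, 2 ^ a3 :: int) \<in> set (map (\<lambda>k. (k, 2 ^ k :: int)) [0..<3])"
    unfolding set_map set_upt using le a by (auto intro!: image_eqI[OF refl])
  have order: "\<not> n1 < n2" using le by simp
  have pos: "\<not> balancing n1 + balancing n2 < 2 ^ a1"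
    "\<not> balancing n1 + balancing n2 - 2 ^ a1 < 2 ^ a2"
    "balancing n1 + balancing n2 - 2 ^ a1 - 2 ^ a2 = 2 ^ a3"
    using sol add_pos_pos[of "2 ^ a2 :: int" "2 ^ a3"] by simp_all
  have "(n1, n2, a1, a2, a3) \<in> set small_solutions"
    using small_solutions_complete[unfolded Let_def list_all_iff, THEN bspec, OF mem(1),
        unfolded prod.case, THEN bspec, OF mem(2), unfolded prod.case if_not_P[OF order],
        THEN bspec, OF mem(3), unfolded prod.case if_not_P[OF pos(1)],
        THEN bspec, OF mem(4), unfolded prod.case if_not_P[OF pos(2)],
        THEN bspec, OF mem(5), unfolded prod.case if_P[OF pos(3)] if_P[OF le(2)] if_P[OF le(3)]] .
  then show "(n1, n2, a1, a2, a3) \<in> ?T"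
    by (simp add: small_solutions_def)
next
  fix n1 n2 a1 a2 a3
  assume "(n1, n2, a1, a2, a3) \<in> ?T"
  then show "(n1, n2, a1, a2, a3) \<in> ?S"
    by (auto simp: eval_nat_numeral)
qed

end
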